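(* Let $\delta,\beta\in(0,1)$ and let $R^{(0)},R^{(1)},R^{(2)},\ldots$ be i.i.d. real random variables with distribution $\mathbb{P}$ and cumulative distribution function $F$. For each $K\ge1$ let $p_K:=1-\delta+\sqrt{\ln(1/\beta)/(2K)}$ and $$\bar\alpha_{\mathrm{CP}}:=\mathrm{Quantile}_{p_K}(R^{(1)},\ldots,R^{(K)},\infty).$$ Let $\alpha:=\inf\{a\in\mathbb{R}: F(a)\ge 1-\delta\}$ be the $(1-\delta)$-quantile of $R^{(0)}$. Suppose $F$ is continuous and strictly increasing in a neighborhood of $\alpha$. Then: (i) $\bar\alpha_{\mathrm{CP}}\to\alpha$ almost surely as $K\to\infty$. (ii) For any $t\in\mathbb{R}$, $$\mathbb{P}^K\bigl(\bar\alpha_{\mathrm{CP}}\le t\bigr)=\sum_{i=m_{\mathrm{CP}}}^{K}\binom{K}{i}F(t)^i\bigl(1-F(t)\bigr)^{K-i},\qquad m_{\mathrm{CP}}:=\lceil (K+1)p_K\rceil .$$ (iii) If, furthermore, $F$ is differentiable at $\alpha$ with density $f(\alpha)=F'(\alpha)>0$, then as $K\to\infty$ $$\sqrt{K}\,(\bar\alpha_{\mathrm{CP}}-\alpha)\xrightarrow{d}\frac{\sqrt{\delta(1-\delta)}}{f(\alpha)}N(0,1)+\frac{1}{f(\alpha)}\sqrt{\frac{\ln(1/\beta)}{2}},$$ where $\xrightarrow{d}$ denotes convergence in distribution and $N(0,1)$ a standard normal random variable.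
   Context: $\mathbb{P}^K=\mathbb{P}^{\otimes K}$ denotes probability over the i.i.d. sample $R^{(1)},\ldots,R^{(K)}$. For values $a_1,\ldots,a_n\in\mathbb{R}\cup\{\infty\}$ and a level $p$, $\mathrm{Quantile}_p(a_1,\ldots,a_n)$ is the $\lceil np\rceil$-th smallest of them. For $\mathrm{Quantile}_{p_K}(R^{(1)},\ldots,R^{(K)},\infty)$ there are $n=K+1$ values; whenever $p_K>K/(K+1)$ (including $p_K\ge1$) its value is $\infty$. A sum whose lower index exceeds its upper index is $0$. *)

theory Defs
  imports "HOL-Probability.Probability"
begin

text \<open>
  \<open>Quantile p [a\<^sub>1, \<dots>, a\<^sub>n]\<close> is the \<open>\<lceil>n p\<rceil>\<close>-th smallest of the values, counted with
  multiplicity and from one, hence the index shift. Levels with \<open>\<lceil>n p\<rceil> > n\<close> give \<open>\<infinity>\<close>.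
  Levels \<open>p \<le> 0\<close>, where no such order statistic exists, are not meaningful.
\<close>

definition Quantile :: "real \<Rightarrow> ereal list \<Rightarrow> ereal" where
  "Quantile p as =
     (let k = nat \<lceil>real (length as) * p\<rceil>
      in if k \<le> length as then sort as ! (k - 1) else \<infinity>)"

definition p_CP :: "real \<Rightarrow> real \<Rightarrow> nat \<Rightarrow> real" where
  "p_CP \<delta> \<beta> K = 1 - \<delta> + sqrt (ln (1 / \<beta>) / (2 * real K))"

definition alpha_CP :: "real \<Rightarrow> real \<Rightarrow> nat \<Rightarrow> (nat \<Rightarrow> real) \<Rightarrow> ereal" where
  "alpha_CP \<delta> \<beta> K r = Quantile (p_CP \<delta> \<beta> K) (map (\<lambda>i. ereal (r i)) [1..<K + 1] @ [\<infinity>])"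

definition m_CP :: "real \<Rightarrow> real \<Rightarrow> nat \<Rightarrow> nat" where
  "m_CP \<delta> \<beta> K = nat \<lceil>real (K + 1) * p_CP \<delta> \<beta> K\<rceil>"

text \<open>
  Convergence in distribution to a real law \<open>\<mu>\<close>, for random variables that may take infinite
  values: pointwise convergence of \<open>x \<mapsto> \<P>(X\<^sub>n \<le> x)\<close> at the continuity points of the
  distribution function of \<open>\<mu>\<close>. As \<open>\<mu>\<close> is a probability measure on the reals, this forces
  \<open>\<P>(\<bar>X\<^sub>n\<bar> = \<infinity>)\<close> to tend to 0; for real-valued \<open>X\<^sub>n\<close> it is \<open>weak_conv_m\<close> of the laws.
\<close>

definition converges_in_distribution ::
    "'a measure \<Rightarrow> (nat \<Rightarrow> 'a \<Rightarrow> ereal) \<Rightarrow> real measure \<Rightarrow> bool" where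
  "converges_in_distribution M X \<mu> \<longleftrightarrow>
     (\<forall>n. X n \<in> borel_measurable M) \<and>
     weak_conv (\<lambda>n x. measure M {\<omega> \<in> space M. X n \<omega> \<le> ereal x}) (cdf \<mu>)"

end

theory Submission
  imports Defs "HOL-Real_Asymp.Real_Asymp"
begin

text \<open>
  The threshold \<open>alpha_CP\<close> is an order statistic, so it is at most \<open>t\<close> exactly if at least \<open>m_CP\<close> of the
  sample values are at most \<open>t\<close> (\<open>alpha_CP_le_iff\<close>). Every assertion thereby becomes one about the
  number of sample values below a level, which is a sum of independent indicators of mean \<open>F t\<close>.

  The exact law of the threshold is the upper tail of the binomial law of this count
  (\<open>measure_PiM_count_below\<close>).

  For almost sure convergence, the relative rank \<open>m_CP / K\<close> tends to \<open>1 - \<delta>\<close>, while the relative count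
  at \<open>t\<close> tends to \<open>F t\<close> almost surely (\<open>AE_count_div_tendsto\<close>). Strict monotonicity of \<open>F\<close> at \<open>\<alpha>\<close>
  separates \<open>F t\<close> from \<open>1 - \<delta>\<close> on both sides of \<open>\<alpha>\<close>, so the threshold is caught between any two
  levels around \<open>\<alpha>\<close>.

  For the limit law, the level \<open>t = \<alpha> + x / sqrt K\<close> moves with \<open>K\<close>. The count at this level differs from
  the count at \<open>\<alpha>\<close> by a drift of about \<open>F' \<alpha> * x * sqrt K\<close> and a random part whose variance is only
  \<open>o(K)\<close> (\<open>count_increment_in_probability\<close>). Hence the classical central limit theorem at the fixed
  level \<open>\<alpha>\<close>, with variance \<open>\<delta> * (1 - \<delta>)\<close> because \<open>F \<alpha> = 1 - \<delta>\<close> by continuity, together with a Slutsky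
  argument gives the limit (\<open>prob_count_moving_threshold\<close>). The inflation of the level raises the rank
  by \<open>sqrt (ln (1 / \<beta>) / 2) * sqrt K\<close> to leading order, which is the source of the shift of the limit.
\<close>

section \<open>The conformal threshold as an order statistic\<close>

definition count_below :: "(nat \<Rightarrow> real) \<Rightarrow> nat \<Rightarrow> real \<Rightarrow> nat" where
  "count_below r K t = card {i \<in> {1..K}. r i \<le> t}"

lemma nth_sort_le_iff:
  fixes xs :: "'b::linorder list"
  assumes "k < length xs"
  shows "sort xs ! k \<le> y \<longleftrightarrow> k < length (filter (\<lambda>x. x \<le> y) xs)"
proof -
  define ys where "ys = sort xs"
  define S where "S = {i. i < length ys \<and> ys ! i \<le> y}"
  have "length (filter (\<lambda>x. x \<le> y) xs) = length (filter (\<lambda>x. x \<le> y) ys)"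
    by (simp add: ys_def filter_sort)
  also have "\<dots> = card S"
    by (simp add: S_def length_filter_conv_card)
  finally have len: "length (filter (\<lambda>x. x \<le> y) xs) = card S" .
  have ys: "sorted ys" "k < length ys" and finS: "finite S"
    using assms by (auto simp: ys_def S_def)
  show ?thesis
  proof (cases "ys ! k \<le> y")
    case True
    then have "{..k} \<subseteq> S"
      using ys by (auto simp: S_def intro: order_trans[OF sorted_nth_mono])
    from card_mono[OF finS this] True show ?thesis
      by (simp add: len flip: ys_def)
  next
    case False
    have "i < k" if "i \<in> S" for i
    proof (rule ccontr)
      assume "\<not> i < k"
      then have "ys ! k \<le> ys ! i" using that ys by (auto simp: S_def intro: sorted_nth_mono)
      then show False using that False by (auto simp: S_def)
    qed
    then have "S \<subseteq> {..<k}" by auto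
    from card_mono[OF _ this] False show ?thesis
      by (simp add: len flip: ys_def)
  qed
qed

lemma p_CP_eq: "p_CP \<delta> \<beta> K = 1 - \<delta> + sqrt (ln (1 / \<beta>) / 2) / sqrt (real K)"
  by (simp add: p_CP_def real_sqrt_divide real_sqrt_mult)

lemma p_CP_pos:
  assumes "\<delta> < 1" "0 < \<beta>" "\<beta> < 1"
  shows "0 < p_CP \<delta> \<beta> K"
  using assms by (simp add: p_CP_eq add_pos_nonneg)

lemma m_CP_pos:
  assumes "\<delta> < 1" "0 < \<beta>" "\<beta> < 1"
  shows "0 < m_CP \<delta> \<beta> K"
  using p_CP_pos[OF assms, of K] by (simp add: m_CP_def)

text \<open>
  The appended value \<open>\<infinity>\<close> is never counted, and if \<open>m_CP\<close> exceeds the number of values the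
  threshold is \<open>\<infinity>\<close> while the count is at most \<open>K\<close>; so no case distinction survives. The
  hypotheses make the level positive and hence the rank at least one. All three parts of the
  theorem use the threshold only through this equivalence.
\<close>

lemma alpha_CP_le_iff:
  assumes "\<delta> < 1" "0 < \<beta>" "\<beta> < 1"
  shows "alpha_CP \<delta> \<beta> K r \<le> ereal t \<longleftrightarrow> m_CP \<delta> \<beta> K \<le> count_below r K t"
proof -
  define as where "as = map (\<lambda>i. ereal (r i)) [1..<K + 1] @ [\<infinity>]"
  define m where "m = m_CP \<delta> \<beta> K"
  have m: "0 < m" using m_CP_pos[OF assms] by (simp add: m_def)
  have len: "length as = K + 1" by (simp add: as_def)
  have alpha: "alpha_CP \<delta> \<beta> K r = (if m \<le> K + 1 then sort as ! (m - 1) else \<infinity>)"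
    unfolding alpha_CP_def Quantile_def m_def m_CP_def Let_def as_def[symmetric] len ..
  have "filter (\<lambda>x. x \<le> ereal t) as = map (\<lambda>i. ereal (r i)) (filter (\<lambda>i. r i \<le> t) [1..<K + 1])"
    by (simp add: as_def filter_map o_def)
  then have "length (filter (\<lambda>x. x \<le> ereal t) as) = card (set (filter (\<lambda>i. r i \<le> t) [1..<K + 1]))"
    by (subst distinct_card) auto
  also have "set (filter (\<lambda>i. r i \<le> t) [1..<K + 1]) = {i \<in> {1..K}. r i \<le> t}"
    by auto
  finally have cnt: "length (filter (\<lambda>x. x \<le> ereal t) as) = count_below r K t"
    by (simp add: count_below_def)
  have "count_below r K t \<le> card {1..K}"
    unfolding count_below_def by (rule card_mono) auto
  then have cntK: "count_below r K t \<le> K" by simp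
  show ?thesis
  proof (cases "m \<le> K + 1")
    case True
    then show ?thesis
      using nth_sort_le_iff[of "m - 1" as "ereal t"] m
      by (simp add: alpha len cnt flip: m_def) linarith
  next
    case False
    then show ?thesis using cntK by (simp add: alpha flip: m_def)
  qed
qed

lemma count_below_eq_sum:
  "real (count_below r K t) = (\<Sum>i\<in>{1..K}. indicator {..t} (r i))"
proof -
  have "(\<Sum>i\<in>{1..K}. indicator {..t} (r i) :: real) = (\<Sum>i\<in>{i\<in>{1..K}. r i \<le> t}. 1)"
    by (intro sum.mono_neutral_cong_right) (auto simp: indicator_def)
  then show ?thesis by (simp add: count_below_def)
qed

lemma m_CP_bounds:
  assumes "\<delta> < 1" "0 < \<beta>" "\<beta> < 1"
  shows "real (K + 1) * p_CP \<delta> \<beta> K \<le> real (m_CP \<delta> \<beta> K)"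
    and "real (m_CP \<delta> \<beta> K) \<le> real (K + 1) * p_CP \<delta> \<beta> K + 1"
proof -
  have "0 < real (K + 1) * p_CP \<delta> \<beta> K"
    using p_CP_pos[OF assms] by simp
  then show "real (K + 1) * p_CP \<delta> \<beta> K \<le> real (m_CP \<delta> \<beta> K)"
    "real (m_CP \<delta> \<beta> K) \<le> real (K + 1) * p_CP \<delta> \<beta> K + 1"
    unfolding m_CP_def by linarith+
qed

text \<open>
  The inflation of the level is of order \<open>1 / sqrt K\<close>, hence it moves the rank by order \<open>sqrt K\<close>, the
  scale of the fluctuations of the count: this shift vanishes in the almost sure limit and survives as
  the displacement of the limiting normal law. The \<open>K + 1\<close> and the rounding contribute only \<open>O(1)\<close>.
\<close>

lemma m_CP_sqrt_asymp:
  assumes "\<delta> < 1" "0 < \<beta>" "\<beta> < 1"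
  shows "(\<lambda>K. (real (m_CP \<delta> \<beta> K) - real K * (1 - \<delta>)) / sqrt (real K)) \<longlonglongrightarrow> sqrt (ln (1 / \<beta>) / 2)"
proof -
  define q where "q = 1 - \<delta>"
  define s where "s = sqrt (ln (1 / \<beta>) / 2)"
  have p: "p_CP \<delta> \<beta> K = q + s / sqrt (real K)" for K
    by (simp add: p_CP_eq q_def s_def)
  show ?thesis
    unfolding q_def[symmetric] s_def[symmetric]
  proof (rule tendsto_sandwich)
    show "\<forall>\<^sub>F K in sequentially.
        (real (K + 1) * (q + s / sqrt (real K)) - real K * q) / sqrt (real K)
        \<le> (real (m_CP \<delta> \<beta> K) - real K * q) / sqrt (real K)"
      using m_CP_bounds(1)[OF assms] by (intro always_eventually allI divide_right_mono) (auto simp: p)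
    show "\<forall>\<^sub>F K in sequentially. (real (m_CP \<delta> \<beta> K) - real K * q) / sqrt (real K)
        \<le> (real (K + 1) * (q + s / sqrt (real K)) + 1 - real K * q) / sqrt (real K)"
      using m_CP_bounds(2)[OF assms] by (intro always_eventually allI divide_right_mono) (auto simp: p)
    show "(\<lambda>K. (real (K + 1) * (q + s / sqrt (real K)) - real K * q) / sqrt (real K)) \<longlonglongrightarrow> s"
      by real_asymp
    show "(\<lambda>K. (real (K + 1) * (q + s / sqrt (real K)) + 1 - real K * q) / sqrt (real K)) \<longlonglongrightarrow> s"
      by real_asymp
  qed
qed

lemma m_CP_div_tendsto:
  assumes "\<delta> < 1" "0 < \<beta>" "\<beta> < 1"
  shows "(\<lambda>K. real (m_CP \<delta> \<beta> K) / real K) \<longlonglongrightarrow> 1 - \<delta>"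
proof -
  have "(\<lambda>K. (1 - \<delta>) + (real (m_CP \<delta> \<beta> K) - real K * (1 - \<delta>)) / sqrt (real K) * (1 / sqrt (real K)))
          \<longlonglongrightarrow> (1 - \<delta>) + sqrt (ln (1 / \<beta>) / 2) * 0"
    by (intro tendsto_add tendsto_mult tendsto_const m_CP_sqrt_asymp[OF assms]) real_asymp
  moreover have "\<forall>\<^sub>F K in sequentially.
      (1 - \<delta>) + (real (m_CP \<delta> \<beta> K) - real K * (1 - \<delta>)) / sqrt (real K) * (1 / sqrt (real K))
      = real (m_CP \<delta> \<beta> K) / real K"
    using eventually_gt_at_top[of 0] by eventually_elim (simp add: field_simps)
  ultimately show ?thesis
    by (simp add: tendsto_cong)
qed

lemma scaled_le_iff:
  assumes "0 < s"
  shows "ereal s * (a - ereal b) \<le> ereal x \<longleftrightarrow> a \<le> ereal (b + x / s)"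
  using assms by (cases a) (auto simp: field_simps)

lemma borel_measurable_ereal_of_atMost:
  fixes f :: "'a \<Rightarrow> ereal"
  assumes "\<And>t::real. {\<omega> \<in> space M. f \<omega> \<le> ereal t} \<in> sets M"
  shows "f \<in> borel_measurable M"
proof (rule borel_measurableI_le)
  fix y :: ereal
  show "{x \<in> space M. f x \<le> y} \<in> sets M"
  proof (cases y)
    case MInf
    \<comment> \<open>The only half-line not given by a real bound or trivial; it is a countable intersection.\<close>
    have "{x \<in> space M. f x \<le> y} = (\<Inter>n. {x \<in> space M. f x \<le> ereal (- real n)})"
    proof -
      have "f x \<le> -\<infinity>" if "\<And>n. f x \<le> ereal (- real n)" for x
      proof (rule ereal_bot[THEN eq_refl])
        fix B :: real
        obtain n :: nat where "- B \<le> real n" using real_arch_simple by blast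
        then show "f x \<le> ereal B" using order_trans[OF that[of n], of "ereal B"] by simp
      qed
      then show ?thesis unfolding MInf by (auto intro: order_trans)
    qed
    then show ?thesis using assms by auto
  qed (use assms in auto)
qed

section \<open>The binomial law of the count\<close>

text \<open>
  The event splits according to the set \<open>S\<close> of indices with values at most \<open>t\<close>. Each piece is a box of
  the product space, of measure depending only on \<open>card S\<close>, and there are \<open>K choose i\<close> sets of size \<open>i\<close>.
\<close>

lemma measure_PiM_count_below:
  assumes "prob_space P" and sets_P [measurable_cong]: "sets P = sets borel"
  shows "measure (Pi\<^sub>M {1..K} (\<lambda>_. P))
           {r \<in> space (Pi\<^sub>M {1..K} (\<lambda>_. P)). m \<le> count_below r K t}
         = (\<Sum>i = m..K. real (K choose i) * cdf P t ^ i * (1 - cdf P t) ^ (K - i))"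
proof -
  interpret P: prob_space P by fact
  interpret Q: finite_product_prob_space "\<lambda>_. P" "{1..K}"
    by unfold_locales auto
  have space_P: "space P = UNIV"
    using sets_eq_imp_space_eq[OF sets_P] by simp
  have [measurable]: "{..t} \<in> sets P" "{t<..} \<in> sets P"
    using sets_P by auto
  have compl: "measure P {t<..} = 1 - cdf P t"
    using P.prob_compl[of "{..t}"] by (simp add: cdf_def space_P Compl_eq_Diff_UNIV[symmetric])
  define B where "B S = (\<Pi>\<^sub>E j\<in>{1..K}. if j \<in> S then {..t} else {t<..})" for S
  define \<S> where "\<S> = {S. S \<subseteq> {1..K} \<and> m \<le> card S}"
  have B_sets: "B S \<in> sets (Pi\<^sub>M {1..K} (\<lambda>_. P))" for S
    unfolding B_def by (rule sets_PiM_I_finite) auto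
  have B_S: "{i \<in> {1..K}. r i \<le> t} = S" if "r \<in> B S" "S \<subseteq> {1..K}" for r S
    using that unfolding B_def by (force simp: PiE_iff split: if_splits)
  have B_mem: "r \<in> B {i \<in> {1..K}. r i \<le> t}" if "r \<in> extensional {1..K}" for r
    using that unfolding B_def by (auto simp: PiE_iff)
  have prob_B: "measure (Pi\<^sub>M {1..K} (\<lambda>_. P)) (B S) = cdf P t ^ card S * (1 - cdf P t) ^ (K - card S)"
    if "S \<subseteq> {1..K}" for S
  proof -
    have "measure (Pi\<^sub>M {1..K} (\<lambda>_. P)) (B S)
        = (\<Prod>j\<in>{1..K}. measure P (if j \<in> S then {..t} else {t<..}))"
      unfolding B_def by (rule Q.prob_times) auto
    also have "\<dots> = (\<Prod>j\<in>{1..K}. if j \<in> S then cdf P t else 1 - cdf P t)"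
      by (intro prod.cong) (auto simp: compl cdf_def)
    also have "\<dots> = cdf P t ^ card ({1..K} \<inter> S) * (1 - cdf P t) ^ card ({1..K} - S)"
      by (subst prod.If_cases) (auto simp: Diff_eq)
    also have "{1..K} \<inter> S = S" using that by auto
    also have "card ({1..K} - S) = K - card S"
      using that by (subst card_Diff_subset) (auto intro: finite_subset)
    finally show ?thesis .
  qed
  have "{r \<in> space (Pi\<^sub>M {1..K} (\<lambda>_. P)). m \<le> count_below r K t} = (\<Union>S\<in>\<S>. B S)"
  proof (intro set_eqI iffI)
    fix r assume "r \<in> {r \<in> space (Pi\<^sub>M {1..K} (\<lambda>_. P)). m \<le> count_below r K t}"
    then have "r \<in> extensional {1..K}" "m \<le> card {i \<in> {1..K}. r i \<le> t}"
      by (auto simp: space_PiM PiE_def count_below_def)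
    then show "r \<in> (\<Union>S\<in>\<S>. B S)"
      using B_mem by (intro UN_I[of "{i \<in> {1..K}. r i \<le> t}"]) (auto simp: \<S>_def)
  next
    fix r assume "r \<in> (\<Union>S\<in>\<S>. B S)"
    then obtain S where S: "S \<subseteq> {1..K}" "m \<le> card S" "r \<in> B S" by (auto simp: \<S>_def)
    then have "r \<in> space (Pi\<^sub>M {1..K} (\<lambda>_. P))"
      by (auto simp: B_def space_PiM space_P PiE_iff)
    then show "r \<in> {r \<in> space (Pi\<^sub>M {1..K} (\<lambda>_. P)). m \<le> count_below r K t}"
      using S B_S[OF S(3,1)] by (auto simp: count_below_def)
  qed
  also have "measure (Pi\<^sub>M {1..K} (\<lambda>_. P)) (\<Union>S\<in>\<S>. B S) = (\<Sum>S\<in>\<S>. measure (Pi\<^sub>M {1..K} (\<lambda>_. P)) (B S))"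
  proof (rule Q.finite_measure_finite_Union)
    show "finite \<S>" by (rule finite_subset[of _ "Pow {1..K}"]) (auto simp: \<S>_def)
    show "B ` \<S> \<subseteq> sets (Pi\<^sub>M {1..K} (\<lambda>_. P))" using B_sets by auto
    show "disjoint_family_on B \<S>"
      unfolding disjoint_family_on_def
    proof (intro ballI impI)
      fix S T assume "S \<in> \<S>" "T \<in> \<S>" "S \<noteq> T"
      then show "B S \<inter> B T = {}"
        using B_S[of _ S] B_S[of _ T] by (fastforce simp: \<S>_def)
    qed
  qed
  also have "\<dots> = (\<Sum>S\<in>\<S>. cdf P t ^ card S * (1 - cdf P t) ^ (K - card S))"
    by (intro sum.cong refl prob_B) (simp add: \<S>_def)
  also have "\<dots> = (\<Sum>i = m..K. \<Sum>S\<in>{S\<in>\<S>. card S = i}. cdf P t ^ card S * (1 - cdf P t) ^ (K - card S))"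
  proof (rule sum.group[symmetric])
    show "finite \<S>" by (rule finite_subset[of _ "Pow {1..K}"]) (auto simp: \<S>_def)
    show "card ` \<S> \<subseteq> {m..K}"
      using card_mono[of "{1..K}"] by (auto simp: \<S>_def)
  qed simp
  also have "\<dots> = (\<Sum>i = m..K. real (K choose i) * cdf P t ^ i * (1 - cdf P t) ^ (K - i))"
  proof (rule sum.cong[OF refl])
    fix i assume "i \<in> {m..K}"
    then have "{S\<in>\<S>. card S = i} = {S. S \<subseteq> {1..K} \<and> card S = i}"
      by (auto simp: \<S>_def)
    then have "card {S\<in>\<S>. card S = i} = K choose i"
      by (simp add: n_subsets)
    then show "(\<Sum>S\<in>{S\<in>\<S>. card S = i}. cdf P t ^ card S * (1 - cdf P t) ^ (K - card S))
        = real (K choose i) * cdf P t ^ i * (1 - cdf P t) ^ (K - i)"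
      by simp
  qed
  finally show ?thesis .
qed

section \<open>Independent sums and perturbed limit laws\<close>

lemma (in prob_space) indep_vars_reindex_inj:
  assumes "indep_vars (\<lambda>_. N) X UNIV" "inj f"
  shows "indep_vars (\<lambda>_. N) (\<lambda>i. X (f i)) UNIV"
proof -
  let ?E = "\<lambda>i. {X i -` A \<inter> space M |A. A \<in> sets N}"
  have rv: "\<And>i. random_variable N (X i)" and ind: "indep_sets ?E UNIV"
    using assms(1) unfolding indep_vars_def2 by auto
  have "indep_sets (\<lambda>i. ?E (f i)) UNIV"
  proof (rule indep_setsI)
    show "?E (f i) \<subseteq> events" for i
      using rv by (auto intro: measurable_sets)
  next
    fix A J assume J: "J \<noteq> {}" "finite J" and A: "\<forall>j\<in>J. A j \<in> ?E (f j)"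
    define B where "B = (\<lambda>i. A (inv f i))"
    have B: "B (f j) = A j" for j using \<open>inj f\<close> by (simp add: B_def)
    have "prob (\<Inter>i\<in>f ` J. B i) = (\<Prod>i\<in>f ` J. prob (B i))"
      using J A by (intro indep_setsD[OF ind]) (auto simp: B)
    then show "prob (\<Inter>j\<in>J. A j) = (\<Prod>j\<in>J. prob (A j))"
      using \<open>inj f\<close> by (simp add: B prod.reindex inj_on_subset)
  qed
  then show ?thesis
    using rv unfolding indep_vars_def2 by simp
qed

lemma (in prob_space) indep_centered_sum_second_moment:
  fixes X :: "'i \<Rightarrow> 'a \<Rightarrow> real"
  assumes "finite I" and ind: "indep_vars (\<lambda>_. borel) X I"
    and sq: "\<And>i. i \<in> I \<Longrightarrow> integrable M (\<lambda>\<omega>. (X i \<omega>)\<^sup>2)"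
    and mean: "\<And>i. i \<in> I \<Longrightarrow> expectation (X i) = 0"
  shows "integrable M (\<lambda>\<omega>. (\<Sum>i\<in>I. X i \<omega>)\<^sup>2)"
    and "expectation (\<lambda>\<omega>. (\<Sum>i\<in>I. X i \<omega>)\<^sup>2) = (\<Sum>i\<in>I. expectation (\<lambda>\<omega>. (X i \<omega>)\<^sup>2))"
proof -
  have rv: "random_variable borel (X i)" if "i \<in> I" for i
    using ind that unfolding indep_vars_def2 by auto
  have int: "integrable M (X i)" if "i \<in> I" for i
    using square_integrable_imp_integrable[OF rv[OF that] sq[OF that]] .
  have *: "integrable M (\<lambda>\<omega>. X i \<omega> * X j \<omega>) \<and>
      expectation (\<lambda>\<omega>. X i \<omega> * X j \<omega>) = (if i = j then expectation (\<lambda>\<omega>. (X i \<omega>)\<^sup>2) else 0)"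
    if ij: "i \<in> I" "j \<in> I" for i j
  proof (cases "i = j")
    case True
    then show ?thesis using sq[OF ij(1)] by (simp add: power2_eq_square)
  next
    case False
    have ind2: "indep_vars (\<lambda>_. borel) X {i, j}"
      using ind by (rule indep_vars_subset) (use ij in auto)
    have "integrable M (\<lambda>\<omega>. \<Prod>k\<in>{i, j}. X k \<omega>)"
      by (rule indep_vars_integrable[OF _ ind2]) (use ij int in auto)
    moreover have "expectation (\<lambda>\<omega>. \<Prod>k\<in>{i, j}. X k \<omega>) = (\<Prod>k\<in>{i, j}. expectation (X k))"
      by (rule indep_vars_lebesgue_integral[OF _ ind2]) (use ij int in auto)
    ultimately show ?thesis using False mean ij by simp
  qed
  have expand: "(\<lambda>\<omega>. (\<Sum>i\<in>I. X i \<omega>)\<^sup>2) = (\<lambda>\<omega>. \<Sum>i\<in>I. \<Sum>j\<in>I. X i \<omega> * X j \<omega>)"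
    by (simp add: power2_eq_square sum_product)
  show "integrable M (\<lambda>\<omega>. (\<Sum>i\<in>I. X i \<omega>)\<^sup>2)"
    unfolding expand using * by auto
  have "expectation (\<lambda>\<omega>. (\<Sum>i\<in>I. X i \<omega>)\<^sup>2)
      = (\<Sum>i\<in>I. \<Sum>j\<in>I. expectation (\<lambda>\<omega>. X i \<omega> * X j \<omega>))"
    unfolding expand using * by (simp add: Bochner_Integration.integral_sum)
  also have "\<dots> = (\<Sum>i\<in>I. \<Sum>j\<in>I. if i = j then expectation (\<lambda>\<omega>. (X i \<omega>)\<^sup>2) else 0)"
    using * by (intro sum.cong) auto
  also have "\<dots> = (\<Sum>i\<in>I. expectation (\<lambda>\<omega>. (X i \<omega>)\<^sup>2))"
    using \<open>finite I\<close> by simp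
  finally show "expectation (\<lambda>\<omega>. (\<Sum>i\<in>I. X i \<omega>)\<^sup>2) = (\<Sum>i\<in>I. expectation (\<lambda>\<omega>. (X i \<omega>)\<^sup>2))" .
qed

text \<open>
  Slutsky's lemma at one point: up to an event of vanishing probability, \<open>Z n + D n \<le> c\<close> lies
  between \<open>Z n \<le> c - e\<close> and \<open>Z n \<le> c + e\<close>, and \<open>G\<close> is continuous at \<open>c\<close>.
\<close>

lemma (in prob_space) prob_sum_le_tendsto:
  fixes Z D :: "nat \<Rightarrow> 'a \<Rightarrow> real"
  assumes [measurable]: "\<And>n. random_variable borel (Z n)" "\<And>n. random_variable borel (D n)"
    and Z: "\<And>y. (\<lambda>n. prob {\<omega> \<in> space M. Z n \<omega> \<le> y}) \<longlonglongrightarrow> G y"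
    and D: "\<And>e. e > 0 \<Longrightarrow> (\<lambda>n. prob {\<omega> \<in> space M. e \<le> \<bar>D n \<omega>\<bar>}) \<longlonglongrightarrow> 0"
    and G: "isCont G c"
  shows "(\<lambda>n. prob {\<omega> \<in> space M. Z n \<omega> + D n \<omega> \<le> c}) \<longlonglongrightarrow> G c"
proof (rule order_tendstoI)
  have nbhd: "\<exists>e>0. \<bar>G (c - e) - G c\<bar> < r \<and> \<bar>G (c + e) - G c\<bar> < r" if "r > 0" for r
  proof -
    obtain d where "d > 0" "\<And>x. \<bar>x - c\<bar> < d \<Longrightarrow> \<bar>G x - G c\<bar> < r"
      using G \<open>r > 0\<close> unfolding continuous_at_eps_delta dist_real_def by metis
    then show ?thesis by (intro exI[of _ "d / 2"]) auto
  qed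
  fix a
  {
    assume "a < G c"
    then obtain e where e: "e > 0" "a < G (c - e)"
      using nbhd[of "G c - a"] by fastforce
    have "(\<lambda>n. prob {\<omega> \<in> space M. Z n \<omega> \<le> c - e} - prob {\<omega> \<in> space M. e \<le> \<bar>D n \<omega>\<bar>}) \<longlonglongrightarrow> G (c - e) - 0"
      by (intro tendsto_diff Z D e)
    then have "\<forall>\<^sub>F n in sequentially.
        a < prob {\<omega> \<in> space M. Z n \<omega> \<le> c - e} - prob {\<omega> \<in> space M. e \<le> \<bar>D n \<omega>\<bar>}"
      using e by (auto dest: order_tendstoD)
    then show "\<forall>\<^sub>F n in sequentially. a < prob {\<omega> \<in> space M. Z n \<omega> + D n \<omega> \<le> c}"
    proof eventually_elim
      fix n
      assume *: "a < prob {\<omega> \<in> space M. Z n \<omega> \<le> c - e} - prob {\<omega> \<in> space M. e \<le> \<bar>D n \<omega>\<bar>}"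
      have "prob {\<omega> \<in> space M. Z n \<omega> \<le> c - e} \<le>
          prob ({\<omega> \<in> space M. Z n \<omega> + D n \<omega> \<le> c} \<union> {\<omega> \<in> space M. e \<le> \<bar>D n \<omega>\<bar>})"
        by (intro finite_measure_mono) auto
      also have "\<dots> \<le> prob {\<omega> \<in> space M. Z n \<omega> + D n \<omega> \<le> c} + prob {\<omega> \<in> space M. e \<le> \<bar>D n \<omega>\<bar>}"
        by (intro measure_Un_le) auto
      finally show "a < prob {\<omega> \<in> space M. Z n \<omega> + D n \<omega> \<le> c}" using * by linarith
    qed
  next
    assume "G c < a"
    then obtain e where e: "e > 0" "G (c + e) < a"
      using nbhd[of "a - G c"] by fastforce
    have "(\<lambda>n. prob {\<omega> \<in> space M. Z n \<omega> \<le> c + e} + prob {\<omega> \<in> space M. e \<le> \<bar>D n \<omega>\<bar>}) \<longlonglongrightarrow> G (c + e) + 0"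
      by (intro tendsto_add Z D e)
    then have "\<forall>\<^sub>F n in sequentially.
        prob {\<omega> \<in> space M. Z n \<omega> \<le> c + e} + prob {\<omega> \<in> space M. e \<le> \<bar>D n \<omega>\<bar>} < a"
      using e by (auto dest: order_tendstoD)
    then show "\<forall>\<^sub>F n in sequentially. prob {\<omega> \<in> space M. Z n \<omega> + D n \<omega> \<le> c} < a"
    proof eventually_elim
      fix n
      assume *: "prob {\<omega> \<in> space M. Z n \<omega> \<le> c + e} + prob {\<omega> \<in> space M. e \<le> \<bar>D n \<omega>\<bar>} < a"
      have "prob {\<omega> \<in> space M. Z n \<omega> + D n \<omega> \<le> c} \<le>
          prob ({\<omega> \<in> space M. Z n \<omega> \<le> c + e} \<union> {\<omega> \<in> space M. e \<le> \<bar>D n \<omega>\<bar>})"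
        by (intro finite_measure_mono) auto
      also have "\<dots> \<le> prob {\<omega> \<in> space M. Z n \<omega> \<le> c + e} + prob {\<omega> \<in> space M. e \<le> \<bar>D n \<omega>\<bar>}"
        by (intro measure_Un_le) auto
      finally show "prob {\<omega> \<in> space M. Z n \<omega> + D n \<omega> \<le> c} < a" using * by linarith
    qed
  }
qed

lemma isCont_cdf_std_normal: "isCont (cdf std_normal_distribution) x"
proof -
  interpret real_distribution std_normal_distribution by (rule real_dist_normal_dist)
  have "emeasure std_normal_distribution {x} = 0"
    by (subst emeasure_density) (auto simp: nn_integral_0_iff_AE intro!: AE_I'[of "{x}"])
  then show ?thesis by (simp add: isCont_cdf measure_def)
qed

section \<open>Counts of an i.i.d. sample\<close>

locale iid_sample = prob_space M for M :: "'a measure" +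
  fixes R :: "nat \<Rightarrow> 'a \<Rightarrow> real" and P :: "real measure" and F :: "real \<Rightarrow> real"
  assumes indep: "indep_vars (\<lambda>_. borel) R UNIV"
    and distr_R: "\<And>i. distr M borel (R i) = P"
    and F_def: "F = cdf P"
begin

lemma rv_R [measurable]: "random_variable borel (R i)"
  using indep unfolding indep_vars_def2 by auto

lemma real_distribution_P: "real_distribution P"
  unfolding distr_R[of 0, symmetric] by (rule real_distribution_distr) simp

sublocale P: real_distribution P
  by (rule real_distribution_P)

lemma F_mono: "a \<le> b \<Longrightarrow> F a \<le> F b"
  unfolding F_def by (rule P.cdf_nondecreasing)

lemma integrable_ind [simp]: "integrable M (\<lambda>\<omega>. indicator {..t} (R i \<omega>) :: real)"
  by (rule integrable_const_bound[of _ 1]) (auto simp: indicator_def)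

lemma expectation_ind [simp]: "expectation (\<lambda>\<omega>. indicator {..t} (R i \<omega>)) = F t"
  using integral_distr[of "R i" M borel "indicator {..t} :: real \<Rightarrow> real"]
  by (simp add: distr_R F_def cdf_def)

abbreviation count :: "nat \<Rightarrow> real \<Rightarrow> 'a \<Rightarrow> nat" where
  "count K t \<omega> \<equiv> count_below (\<lambda>i. R i \<omega>) K t"

lemma measurable_count [measurable]: "(\<lambda>\<omega>. real (count K t \<omega>)) \<in> borel_measurable M"
  unfolding count_below_eq_sum by measurable

text \<open>
  Hoeffding's inequality, written as a geometric sequence in \<open>K\<close>.
\<close>

lemma prob_count_deviation:
  assumes "e > 0"
  shows "prob {\<omega> \<in> space M. e \<le> \<bar>real (count K t \<omega>) / real K - F t\<bar>} \<le> 2 * exp (- 2 * e\<^sup>2) ^ K"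
proof (cases "K = 0")
  case True
  \<comment> \<open>The bound is 2 here, and probabilities are at most 1.\<close>
  then show ?thesis using prob_le_1 by (auto intro: order_trans)
next
  case False
  interpret H: Hoeffding_ineq M "{1..K}" "\<lambda>i \<omega>. indicator {..t} (R i \<omega>)" "\<lambda>_. 0" "\<lambda>_. 1" "real K * F t"
  proof unfold_locales
    show "indep_vars (\<lambda>_. borel) (\<lambda>i \<omega>. indicator {..t} (R i \<omega>) :: real) {1..K}"
      by (rule indep_vars_compose2[OF indep_vars_subset[OF indep]]) auto
    show "real K * F t \<equiv> (\<Sum>i\<in>{1..K}. expectation (\<lambda>\<omega>. indicator {..t} (R i \<omega>)))"
      by (rule eq_reflection) simp
  qed (auto simp: indicator_def)
  have "prob {\<omega> \<in> space M. e \<le> \<bar>real (count K t \<omega>) / real K - F t\<bar>}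
      = prob {\<omega> \<in> space M. \<bar>(\<Sum>i\<in>{1..K}. indicator {..t} (R i \<omega>)) - real K * F t\<bar> \<ge> real K * e}"
  proof (rule arg_cong[where f = prob], rule Collect_cong, rule conj_cong[OF refl])
    fix \<omega>
    have "\<bar>real (count K t \<omega>) / real K - F t\<bar> = \<bar>real (count K t \<omega>) - real K * F t\<bar> / real K"
      using False by (subst abs_div_pos) (auto simp: field_simps)
    then show "e \<le> \<bar>real (count K t \<omega>) / real K - F t\<bar> \<longleftrightarrow>
        real K * e \<le> \<bar>(\<Sum>i\<in>{1..K}. indicator {..t} (R i \<omega>)) - real K * F t\<bar>"
      unfolding count_below_eq_sum[symmetric] using False by (simp add: field_simps)
  qed
  also have "\<dots> \<le> 2 * exp (- 2 * (real K * e)\<^sup>2 / (\<Sum>i\<in>{1..K}. (1 - 0)\<^sup>2))"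
    by (rule H.Hoeffding_ineq_abs_ge) (use False \<open>e > 0\<close> in auto)
  also have "- 2 * (real K * e)\<^sup>2 / (\<Sum>i\<in>{1..K}. (1 - 0)\<^sup>2) = real K * (- 2 * e\<^sup>2)"
    using False by (simp add: power2_eq_square)
  also have "exp \<dots> = exp (- 2 * e\<^sup>2) ^ K"
    by (rule exp_of_nat_mult)
  finally show ?thesis .
qed

text \<open>
  The bound of \<open>prob_count_deviation\<close> is summable in \<open>K\<close>, so this strong law follows from the
  Borel-Cantelli lemma.
\<close>

lemma AE_count_div_tendsto:
  "AE \<omega> in M. (\<lambda>K. real (count K t \<omega>) / real K) \<longlonglongrightarrow> F t"
proof -
  have "AE \<omega> in M. \<forall>\<^sub>F K in sequentially.
      \<omega> \<in> space M - {\<omega> \<in> space M. 1 / real (Suc n) \<le> \<bar>real (count K t \<omega>) / real K - F t\<bar>}" for n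
  proof (rule borel_cantelli_AE1)
    show "summable (\<lambda>K. prob {\<omega> \<in> space M. 1 / real (Suc n) \<le> \<bar>real (count K t \<omega>) / real K - F t\<bar>})"
    proof (rule summable_comparison_test')
      show "summable (\<lambda>K. 2 * exp (- 2 * (1 / real (Suc n))\<^sup>2) ^ K)"
        by (intro summable_mult summable_geometric) simp
      show "norm (prob {\<omega> \<in> space M. 1 / real (Suc n) \<le> \<bar>real (count K t \<omega>) / real K - F t\<bar>})
          \<le> 2 * exp (- 2 * (1 / real (Suc n))\<^sup>2) ^ K" if "K \<ge> 0" for K
        using prob_count_deviation[of "1 / real (Suc n)" K t] by simp
    qed
  qed (auto simp: less_top[symmetric])
  then have "AE \<omega> in M. \<forall>n. \<forall>\<^sub>F K in sequentially.
      \<omega> \<in> space M - {\<omega> \<in> space M. 1 / real (Suc n) \<le> \<bar>real (count K t \<omega>) / real K - F t\<bar>}"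
    by (simp add: AE_all_countable)
  then show ?thesis
  proof eventually_elim
    fix \<omega>
    assume *: "\<forall>n. \<forall>\<^sub>F K in sequentially.
      \<omega> \<in> space M - {\<omega> \<in> space M. 1 / real (Suc n) \<le> \<bar>real (count K t \<omega>) / real K - F t\<bar>}"
    show "(\<lambda>K. real (count K t \<omega>) / real K) \<longlonglongrightarrow> F t"
    proof (rule tendstoI)
      fix e :: real assume "e > 0"
      then obtain n where n: "1 / real (Suc n) < e"
        using reals_Archimedean by (auto simp: inverse_eq_divide)
      show "\<forall>\<^sub>F K in sequentially. dist (real (count K t \<omega>) / real K) (F t) < e"
        using *[rule_format, of n] by eventually_elim (use n in \<open>auto simp: dist_real_def\<close>)
    qed
  qed
qed

text \<open>
  The summands are differences of two indicators of nested half-lines, so their squares are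
  indicators of the interval between \<open>a\<close> and \<open>t\<close>, of probability \<open>\<bar>F t - F a\<bar>\<close>; centering
  does not increase the second moment, and independence removes the mixed terms.
\<close>

lemma count_increment_second_moment:
  fixes V :: "'a \<Rightarrow> real"
  assumes "V = (\<lambda>\<omega>. real (count K t \<omega>) - real (count K a \<omega>) - real K * (F t - F a))"
  shows "integrable M (\<lambda>\<omega>. (V \<omega>)\<^sup>2)" "expectation V = 0"
    and "expectation (\<lambda>\<omega>. (V \<omega>)\<^sup>2) \<le> real K * \<bar>F t - F a\<bar>"
proof -
  define Y where "Y i \<omega> = (indicator {..t} (R i \<omega>) - indicator {..a} (R i \<omega>) :: real)" for i \<omega>
  define X where "X i \<omega> = Y i \<omega> - (F t - F a)" for i \<omega>
  have V: "V = (\<lambda>\<omega>. \<Sum>i\<in>{1..K}. X i \<omega>)"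
    unfolding assms X_def Y_def count_below_eq_sum
    by (auto simp: sum_subtractf fun_eq_iff)
  \<comment> \<open>Nested half-lines: the product of the two indicators is the indicator of the smaller one.\<close>
  have Y2: "(Y i \<omega>)\<^sup>2 = indicator {..t} (R i \<omega>) + indicator {..a} (R i \<omega>) - 2 * indicator {..min t a} (R i \<omega>)" for i \<omega>
    by (auto simp: Y_def indicator_def min_def)
  have [simp]: "integrable M (Y i)" "expectation (Y i) = F t - F a" for i
    by (simp_all add: Y_def[abs_def])
  have [simp]: "integrable M (\<lambda>\<omega>. (Y i \<omega>)\<^sup>2)" for i
    unfolding Y2 by (intro Bochner_Integration.integrable_diff Bochner_Integration.integrable_add
      integrable_mult_right integrable_ind)
  have EY2: "expectation (\<lambda>\<omega>. (Y i \<omega>)\<^sup>2) = \<bar>F t - F a\<bar>" for i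
  proof -
    have "expectation (\<lambda>\<omega>. (Y i \<omega>)\<^sup>2) = F t + F a - 2 * F (min t a)"
      unfolding Y2 by simp
    also have "\<dots> = \<bar>F t - F a\<bar>"
      using F_mono[of t a] F_mono[of a t] by (auto simp: min_def)
    finally show ?thesis .
  qed
  have X2: "(X i \<omega>)\<^sup>2 = (Y i \<omega>)\<^sup>2 - 2 * (F t - F a) * Y i \<omega> + (F t - F a)\<^sup>2" for i \<omega>
    unfolding X_def by (simp add: power2_eq_square algebra_simps)
  have intX2: "integrable M (\<lambda>\<omega>. (X i \<omega>)\<^sup>2)" for i
    unfolding X2 by simp
  have meanX: "expectation (X i) = 0" "integrable M (X i)" for i
    unfolding X_def[abs_def] by (simp_all add: prob_space)
  have EX2: "expectation (\<lambda>\<omega>. (X i \<omega>)\<^sup>2) \<le> \<bar>F t - F a\<bar>" for i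
  proof -
    have "expectation (\<lambda>\<omega>. (X i \<omega>)\<^sup>2) = expectation (\<lambda>\<omega>. (Y i \<omega>)\<^sup>2) - (F t - F a)\<^sup>2"
      unfolding X2 by (simp add: prob_space) (simp add: power2_eq_square algebra_simps)
    then show ?thesis by (simp add: EY2)
  qed
  have ind: "indep_vars (\<lambda>_. borel) X {1..K}"
    unfolding X_def[abs_def] Y_def
    by (rule indep_vars_compose2[OF indep_vars_subset[OF indep]]) auto
  show "integrable M (\<lambda>\<omega>. (V \<omega>)\<^sup>2)"
    unfolding V by (rule indep_centered_sum_second_moment[OF _ ind]) (auto simp: intX2 meanX)
  show "expectation V = 0"
    unfolding V by (simp add: meanX)
  have "expectation (\<lambda>\<omega>. (V \<omega>)\<^sup>2) = (\<Sum>i\<in>{1..K}. expectation (\<lambda>\<omega>. (X i \<omega>)\<^sup>2))"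
    unfolding V by (rule indep_centered_sum_second_moment[OF _ ind]) (auto simp: intX2 meanX)
  also have "\<dots> \<le> (\<Sum>i\<in>{1..K}. \<bar>F t - F a\<bar>)"
    by (intro sum_mono EX2)
  finally show "expectation (\<lambda>\<omega>. (V \<omega>)\<^sup>2) \<le> real K * \<bar>F t - F a\<bar>"
    by simp
qed

text \<open>
  By Chebyshev's inequality, when the threshold \<open>t K\<close> approaches \<open>a\<close>, replacing it by \<open>a\<close> costs
  only a deterministic drift on the scale \<open>sqrt K\<close>. This reduces a central limit theorem for a
  triangular array to one for a single i.i.d. sequence.
\<close>

lemma count_increment_in_probability:
  assumes F_t: "(\<lambda>K. F (t K)) \<longlonglongrightarrow> F a" and "e > 0"
  shows "(\<lambda>K. prob {\<omega> \<in> space M. e \<le>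
      \<bar>(real (count K (t K) \<omega>) - real (count K a \<omega>) - real K * (F (t K) - F a)) / sqrt (real K)\<bar>}) \<longlonglongrightarrow> 0"
proof (rule tendsto_sandwich[where f = "\<lambda>_. 0" and h = "\<lambda>K. \<bar>F (t K) - F a\<bar> / e\<^sup>2"])
  define V where "V K \<omega> = real (count K (t K) \<omega>) - real (count K a \<omega>) - real K * (F (t K) - F a)" for K \<omega>
  have [measurable]: "random_variable borel (V K)" for K
    unfolding V_def[abs_def] by measurable
  show "\<forall>\<^sub>F K in sequentially. prob {\<omega> \<in> space M. e \<le>
      \<bar>(real (count K (t K) \<omega>) - real (count K a \<omega>) - real K * (F (t K) - F a)) / sqrt (real K)\<bar>}
      \<le> \<bar>F (t K) - F a\<bar> / e\<^sup>2"
    using eventually_gt_at_top[of 0]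
  proof eventually_elim
    fix K :: nat assume K: "0 < K"
    note mom = count_increment_second_moment[of "V K" K "t K" a]
    have "prob {\<omega> \<in> space M. e \<le> \<bar>V K \<omega> / sqrt (real K)\<bar>}
        = prob {\<omega> \<in> space M. e * sqrt (real K) \<le> \<bar>V K \<omega> - expectation (V K)\<bar>}"
      using K mom(2) by (simp add: V_def[abs_def] abs_divide pos_le_divide_eq)
    also have "\<dots> \<le> variance (V K) / (e * sqrt (real K))\<^sup>2"
      by (rule Chebyshev_inequality) (use K \<open>e > 0\<close> mom(1) in \<open>auto simp: V_def[abs_def]\<close>)
    also have "variance (V K) = expectation (\<lambda>\<omega>. (V K \<omega>)\<^sup>2)"
      using mom(2) by (simp add: V_def[abs_def])
    also have "\<dots> / (e * sqrt (real K))\<^sup>2 \<le> (real K * \<bar>F (t K) - F a\<bar>) / (e * sqrt (real K))\<^sup>2"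
      using mom(3) by (intro divide_right_mono) (auto simp: V_def[abs_def])
    also have "\<dots> = \<bar>F (t K) - F a\<bar> / e\<^sup>2"
      using K \<open>e > 0\<close> by (simp add: power_mult_distrib)
    finally show "prob {\<omega> \<in> space M. e \<le>
      \<bar>(real (count K (t K) \<omega>) - real (count K a \<omega>) - real K * (F (t K) - F a)) / sqrt (real K)\<bar>}
      \<le> \<bar>F (t K) - F a\<bar> / e\<^sup>2"
      unfolding V_def .
  qed
  have "(\<lambda>K. \<bar>F (t K) - F a\<bar> / e\<^sup>2) \<longlonglongrightarrow> \<bar>F a - F a\<bar> / e\<^sup>2"
    using \<open>e > 0\<close> by (intro tendsto_intros F_t) auto
  then show "(\<lambda>K. \<bar>F (t K) - F a\<bar> / e\<^sup>2) \<longlonglongrightarrow> 0" by simp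
qed auto

text \<open>
  The sign is reversed (expected minus observed count) because a large count corresponds
  to a small order statistic, and this way only events of the form \<open>_ \<le> y\<close> occur.
\<close>

lemma count_clt:
  assumes "0 < F a" "F a < 1"
  defines "\<sigma> \<equiv> sqrt (F a * (1 - F a))"
  shows "(\<lambda>K. prob {\<omega> \<in> space M. (real K * F a - real (count K a \<omega>)) / (\<sigma> * sqrt (real K)) \<le> y})
    \<longlonglongrightarrow> cdf std_normal_distribution y"
proof -
  \<comment> \<open>The sample entering the counts starts at index 1, the central limit theorem sums from 0.\<close>
  define X where "X i \<omega> = F a - indicator {..a} (R (Suc i) \<omega>)" for i \<omega>
  have \<sigma>: "\<sigma> > 0" "\<sigma>\<^sup>2 = F a * (1 - F a)"
    using assms by (auto simp: \<sigma>_def)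
  have X2: "(X i \<omega>)\<^sup>2 = (F a)\<^sup>2 + (1 - 2 * F a) * indicator {..a} (R (Suc i) \<omega>)" for i \<omega>
    by (auto simp: X_def indicator_def power2_eq_square algebra_simps)
  have mean: "expectation (X i) = 0" for i
    unfolding X_def[abs_def] by (simp add: prob_space)
  have "weak_conv_m (\<lambda>n. distr M borel (\<lambda>\<omega>. (\<Sum>i<n. X i \<omega>) / sqrt (real n * \<sigma>\<^sup>2))) std_normal_distribution"
  proof (rule central_limit_theorem_zero_mean)
    show "indep_vars (\<lambda>i. borel) X UNIV"
      unfolding X_def[abs_def]
      by (rule indep_vars_compose2[OF indep_vars_reindex_inj[OF indep, of Suc]]) auto
    show "integrable M (\<lambda>\<omega>. (X i \<omega>)\<^sup>2)" for i
      unfolding X2 by simp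
    show "variance (X i) = \<sigma>\<^sup>2" for i
      unfolding mean by (simp add: X2 prob_space \<sigma>(2)) (simp add: power2_eq_square algebra_simps)
    show "distr M borel (X i) = distr P borel (\<lambda>x. F a - indicator {..a} x)" for i
      unfolding distr_R[of "Suc i", symmetric] X_def[abs_def]
      by (subst distr_distr) (auto simp: comp_def)
  qed (use \<sigma> mean in auto)
  then have *: "(\<lambda>n. cdf (distr M borel (\<lambda>\<omega>. (\<Sum>i<n. X i \<omega>) / sqrt (real n * \<sigma>\<^sup>2))) y)
      \<longlonglongrightarrow> cdf std_normal_distribution y"
    using isCont_cdf_std_normal by (auto simp: weak_conv_m_def weak_conv_def)
  have sum_X: "(\<Sum>i<n. X i \<omega>) = real n * F a - real (count n a \<omega>)" for n \<omega>
    unfolding X_def count_below_eq_sum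
    by (simp add: sum_subtractf sum.atLeast1_atMost_eq)
  have [measurable]: "random_variable borel (X i)" for i
    unfolding X_def[abs_def] by measurable
  have "cdf (distr M borel (\<lambda>\<omega>. (\<Sum>i<n. X i \<omega>) / sqrt (real n * \<sigma>\<^sup>2))) y
      = prob {\<omega> \<in> space M. (real n * F a - real (count n a \<omega>)) / (\<sigma> * sqrt (real n)) \<le> y}" for n
    unfolding cdf_def
    by (subst measure_distr)
      (use \<sigma>(1) in \<open>auto simp: sum_X real_sqrt_mult mult.commute intro!: arg_cong[where f = prob]\<close>)
  with * show ?thesis by simp
qed

text \<open>
  Divided by \<open>sqrt K\<close>, the inequality \<open>m K \<le> count K (t K)\<close> says that the centred, sign-reversed
  count at the fixed threshold \<open>a\<close> is at most a deterministic term tending to \<open>u - s\<close> plus an error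
  that vanishes in probability. This error and the distance of the deterministic term from its
  limit are collected in \<open>D\<close>.
\<close>

lemma prob_count_moving_threshold:
  assumes q: "0 < F a" "F a < 1"
    and t: "(\<lambda>K. sqrt (real K) * (F (t K) - F a)) \<longlonglongrightarrow> u"
    and m: "(\<lambda>K. (real (m K) - real K * F a) / sqrt (real K)) \<longlonglongrightarrow> s"
  shows "(\<lambda>K. prob {\<omega> \<in> space M. m K \<le> count K (t K) \<omega>})
    \<longlonglongrightarrow> cdf std_normal_distribution ((u - s) / sqrt (F a * (1 - F a)))"
proof -
  define \<sigma> where "\<sigma> = sqrt (F a * (1 - F a))"
  have \<sigma>: "\<sigma> > 0" using q by (simp add: \<sigma>_def)
  define Z where "Z K \<omega> = (real K * F a - real (count K a \<omega>)) / (\<sigma> * sqrt (real K))" for K \<omega>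
  define V where "V K \<omega> = (real (count K (t K) \<omega>) - real (count K a \<omega>) - real K * (F (t K) - F a)) / sqrt (real K)" for K \<omega>
  define c where "c K = sqrt (real K) * (F (t K) - F a) - (real (m K) - real K * F a) / sqrt (real K)" for K
  define D where "D K \<omega> = ((u - s) - c K - V K \<omega>) / \<sigma>" for K \<omega>
  have F_t: "(\<lambda>K. F (t K)) \<longlonglongrightarrow> F a"
  proof -
    have "(\<lambda>K. F a + sqrt (real K) * (F (t K) - F a) * (1 / sqrt (real K))) \<longlonglongrightarrow> F a + u * 0"
      by (intro tendsto_add tendsto_mult tendsto_const t) real_asymp
    moreover have "\<forall>\<^sub>F K in sequentially. F a + sqrt (real K) * (F (t K) - F a) * (1 / sqrt (real K)) = F (t K)"
      using eventually_gt_at_top[of 0] by eventually_elim (simp add: field_simps)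
    ultimately show ?thesis by (simp add: tendsto_cong)
  qed
  have c: "c \<longlonglongrightarrow> u - s"
    unfolding c_def[abs_def] by (intro tendsto_diff t m)
  have V0: "(\<lambda>K. prob {\<omega> \<in> space M. e \<le> \<bar>V K \<omega>\<bar>}) \<longlonglongrightarrow> 0" if "e > 0" for e
    unfolding V_def by (rule count_increment_in_probability[OF F_t that])
  have [measurable]: "random_variable borel (Z K)" "random_variable borel (V K)" "random_variable borel (D K)" for K
    unfolding Z_def[abs_def] V_def[abs_def] D_def[abs_def] by measurable
  have D0: "(\<lambda>K. prob {\<omega> \<in> space M. e \<le> \<bar>D K \<omega>\<bar>}) \<longlonglongrightarrow> 0" if e: "e > 0" for e
  proof (rule tendsto_sandwich[where f = "\<lambda>_. 0" and h = "\<lambda>K. prob {\<omega> \<in> space M. \<sigma> * e / 2 \<le> \<bar>V K \<omega>\<bar>}"])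
    \<comment> \<open>Half of the deviation is left for the deterministic part, which is eventually smaller.\<close>
    have pos: "\<sigma> * e / 2 > 0" using \<sigma> e by simp
    show "(\<lambda>K. prob {\<omega> \<in> space M. \<sigma> * e / 2 \<le> \<bar>V K \<omega>\<bar>}) \<longlonglongrightarrow> 0"
      by (rule V0[OF pos])
    have "\<forall>\<^sub>F K in sequentially. \<bar>c K - (u - s)\<bar> < \<sigma> * e / 2"
      using tendstoD[OF c pos] by (simp add: dist_real_def)
    then show "\<forall>\<^sub>F K in sequentially. prob {\<omega> \<in> space M. e \<le> \<bar>D K \<omega>\<bar>}
        \<le> prob {\<omega> \<in> space M. \<sigma> * e / 2 \<le> \<bar>V K \<omega>\<bar>}"
    proof eventually_elim
      fix K assume cK: "\<bar>c K - (u - s)\<bar> < \<sigma> * e / 2"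
      have "\<sigma> * e / 2 \<le> \<bar>V K \<omega>\<bar>" if "e \<le> \<bar>D K \<omega>\<bar>" for \<omega>
      proof -
        have "\<sigma> * e \<le> \<bar>(u - s) - c K - V K \<omega>\<bar>"
          using that \<sigma> by (simp add: D_def abs_divide field_simps)
        then show ?thesis using cK by linarith
      qed
      then show "prob {\<omega> \<in> space M. e \<le> \<bar>D K \<omega>\<bar>} \<le> prob {\<omega> \<in> space M. \<sigma> * e / 2 \<le> \<bar>V K \<omega>\<bar>}"
        by (intro finite_measure_mono) auto
    qed
  qed auto
  have "(\<lambda>K. prob {\<omega> \<in> space M. Z K \<omega> + D K \<omega> \<le> (u - s) / \<sigma>})
      \<longlonglongrightarrow> cdf std_normal_distribution ((u - s) / \<sigma>)"
    using count_clt[OF q] D0 unfolding \<sigma>_def[symmetric] Z_def[symmetric]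
    by (intro prob_sum_le_tendsto isCont_cdf_std_normal) auto
  moreover have "\<forall>\<^sub>F K in sequentially.
      prob {\<omega> \<in> space M. Z K \<omega> + D K \<omega> \<le> (u - s) / \<sigma>} = prob {\<omega> \<in> space M. m K \<le> count K (t K) \<omega>}"
    using eventually_gt_at_top[of 0]
  proof eventually_elim
    fix K :: nat assume K: "0 < K"
    have "Z K \<omega> + D K \<omega> \<le> (u - s) / \<sigma> \<longleftrightarrow> m K \<le> count K (t K) \<omega>" for \<omega>
    proof -
      have "Z K \<omega> + D K \<omega> = (u - s) / \<sigma> + (real (m K) - real (count K (t K) \<omega>)) / (\<sigma> * sqrt (real K))"
      proof -
        define r where "r = sqrt (real K)"
        have "r > 0" "real K = r * r" using K by (auto simp: r_def)
        then show ?thesis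
          using \<sigma> unfolding Z_def D_def V_def c_def r_def[symmetric] by (simp add: field_simps)
      qed
      moreover have "(real (m K) - real (count K (t K) \<omega>)) / (\<sigma> * sqrt (real K)) \<le> 0 \<longleftrightarrow> m K \<le> count K (t K) \<omega>"
      proof -
        have "\<sigma> * sqrt (real K) > 0" using K \<sigma> by simp
        then show ?thesis by (simp add: pos_divide_le_eq)
      qed
      ultimately show ?thesis by linarith
    qed
    then show "prob {\<omega> \<in> space M. Z K \<omega> + D K \<omega> \<le> (u - s) / \<sigma>} = prob {\<omega> \<in> space M. m K \<le> count K (t K) \<omega>}"
      by simp
  qed
  ultimately show ?thesis
    unfolding \<sigma>_def by (simp add: tendsto_cong)
qed

end

section \<open>Quantiles as infima of levels\<close>

text \<open>
  The infimum belongs to the level set because distribution functions are right-continuous. The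
  limits at both ends make the set nonempty and bounded below, without which \<open>Inf\<close> is unspecified.
\<close>

lemma (in real_distribution) Inf_cdf_level:
  assumes "0 < q" "q < 1"
  defines "a \<equiv> Inf {x. cdf M x \<ge> q}"
  shows "q \<le> cdf M a" and "\<And>x. x < a \<Longrightarrow> cdf M x < q"
proof -
  let ?S = "{x. cdf M x \<ge> q}"
  obtain u where "q < cdf M u"
    using order_tendstoD(1)[OF cdf_lim_at_top_prob \<open>q < 1\<close>] by (auto simp: eventually_at_top_linorder)
  then have ne: "?S \<noteq> {}" by (auto intro: less_imp_le)
  obtain l where l: "cdf M l < q"
    using order_tendstoD(2)[OF cdf_lim_at_bot \<open>0 < q\<close>] by (auto simp: eventually_at_bot_linorder)
  have bdd: "bdd_below ?S"
  proof (rule bdd_belowI)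
    fix x assume "x \<in> ?S"
    then show "l \<le> x" using l cdf_nondecreasing[of x l] by (cases "l \<le> x") auto
  qed
  show "cdf M x < q" if "x < a" for x
  proof (rule ccontr)
    assume "\<not> cdf M x < q"
    then have "a \<le> x" unfolding a_def by (intro cInf_lower bdd) auto
    with that show False by simp
  qed
  have gt: "q \<le> cdf M x" if x: "a < x" for x
  proof -
    obtain y where "y \<in> ?S" "y < x"
      using x cInf_lessD[OF ne, of x] by (auto simp: a_def)
    then show ?thesis using cdf_nondecreasing[of y x] by auto
  qed
  have "(cdf M \<longlongrightarrow> cdf M a) (at_right a)"
    using cdf_is_right_cont[of a] by (simp add: continuous_within)
  moreover have "\<forall>\<^sub>F x in at_right a. q \<le> cdf M x"
    by (auto simp: eventually_at_filter gt)
  ultimately show "q \<le> cdf M a"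
    by (rule tendsto_lowerbound) simp
qed

lemma (in real_distribution) cdf_Inf_level_eq:
  assumes "0 < q" "q < 1" and "isCont (cdf M) (Inf {x. cdf M x \<ge> q})"
  shows "cdf M (Inf {x. cdf M x \<ge> q}) = q"
proof (rule antisym)
  let ?a = "Inf {x. cdf M x \<ge> q}"
  have "(cdf M \<longlongrightarrow> cdf M ?a) (at_left ?a)"
    using assms(3) by (simp add: isCont_def filterlim_at_split)
  moreover have "\<forall>\<^sub>F x in at_left ?a. cdf M x \<le> q"
    using Inf_cdf_level(2)[OF assms(1,2)]
    by (auto simp: eventually_at_filter intro!: always_eventually less_imp_le)
  ultimately show "cdf M ?a \<le> q"
    by (rule tendsto_upperbound) simp
qed (rule Inf_cdf_level(1)[OF assms(1,2)])

section \<open>Limits of the conformal threshold\<close>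

context iid_sample
begin

text \<open>
  At a level \<open>t\<close> with \<open>F t < 1 - \<delta>\<close> the relative count eventually stays below the relative rank,
  which tends to \<open>1 - \<delta>\<close>, and at a level with \<open>F t > 1 - \<delta>\<close> it eventually exceeds it. Countably many
  levels \<open>a \<plusminus> 1 / Suc n\<close> suffice, so the exceptional null sets can be united.
\<close>

lemma AE_alpha_CP_tendsto:
  assumes "0 < \<delta>" "\<delta> < 1" "0 < \<beta>" "\<beta> < 1"
    and below: "\<And>x. x < a \<Longrightarrow> F x < 1 - \<delta>" and above: "\<And>x. a < x \<Longrightarrow> 1 - \<delta> < F x"
  shows "AE \<omega> in M. (\<lambda>K. alpha_CP \<delta> \<beta> K (\<lambda>i. R i \<omega>)) \<longlonglongrightarrow> ereal a"
proof -
  note iff = alpha_CP_le_iff[OF assms(2-4)]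
  have "AE \<omega> in M. \<forall>n. (\<lambda>K. real (count K (a - 1 / real (Suc n)) \<omega>) / real K) \<longlonglongrightarrow> F (a - 1 / real (Suc n))"
    by (simp only: AE_all_countable AE_count_div_tendsto simp_thms)
  moreover have "AE \<omega> in M. \<forall>n. (\<lambda>K. real (count K (a + 1 / real (Suc n)) \<omega>) / real K) \<longlonglongrightarrow> F (a + 1 / real (Suc n))"
    by (simp only: AE_all_countable AE_count_div_tendsto simp_thms)
  ultimately show ?thesis
  proof eventually_elim
    fix \<omega>
    assume lo: "\<forall>n. (\<lambda>K. real (count K (a - 1 / real (Suc n)) \<omega>) / real K) \<longlonglongrightarrow> F (a - 1 / real (Suc n))"
      and hi: "\<forall>n. (\<lambda>K. real (count K (a + 1 / real (Suc n)) \<omega>) / real K) \<longlonglongrightarrow> F (a + 1 / real (Suc n))"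
    let ?A = "\<lambda>K. alpha_CP \<delta> \<beta> K (\<lambda>i. R i \<omega>)"
    have compare: "\<forall>\<^sub>F K in sequentially. f K < g K"
      if "(\<lambda>K. real (f K) / real K) \<longlonglongrightarrow> x" "(\<lambda>K. real (g K) / real K) \<longlonglongrightarrow> y" "x < y"
      for f g :: "nat \<Rightarrow> nat" and x y
    proof -
      obtain z where z: "x < z" "z < y" using dense[OF \<open>x < y\<close>] by auto
      show ?thesis
        using order_tendstoD(2)[OF that(1) z(1)] order_tendstoD(1)[OF that(2) z(2)] eventually_gt_at_top[of 0]
      proof eventually_elim
        case (elim K)
        then have "real (f K) / real K < real (g K) / real K" by linarith
        then show ?case using elim by (simp add: divide_less_cancel)
      qed
    qed
    show "?A \<longlonglongrightarrow> ereal a"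
    proof (rule order_tendstoI)
      fix y assume "y < ereal a"
      then obtain z where z: "y < ereal z" "z < a"
        using ereal_dense2[of y "ereal a"] by auto
      obtain n where n: "1 / real (Suc n) < a - z"
        using reals_Archimedean[of "a - z"] z by (auto simp: inverse_eq_divide)
      have "\<forall>\<^sub>F K in sequentially. count K (a - 1 / real (Suc n)) \<omega> < m_CP \<delta> \<beta> K"
        by (rule compare[OF lo[rule_format] m_CP_div_tendsto[OF assms(2-4)] below]) simp
      then show "\<forall>\<^sub>F K in sequentially. y < ?A K"
      proof eventually_elim
        fix K assume "count K (a - 1 / real (Suc n)) \<omega> < m_CP \<delta> \<beta> K"
        then have "ereal (a - 1 / real (Suc n)) < ?A K"
          using iff[of K "\<lambda>i. R i \<omega>" "a - 1 / real (Suc n)"] by simp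
        moreover have "y < ereal (a - 1 / real (Suc n))"
          using n z by (intro less_trans[OF z(1)]) simp
        ultimately show "y < ?A K" by simp
      qed
    next
      fix y assume "ereal a < y"
      then obtain z where z: "ereal z < y" "a < z"
        using ereal_dense2[of "ereal a" y] by auto
      obtain n where n: "1 / real (Suc n) < z - a"
        using reals_Archimedean[of "z - a"] z by (auto simp: inverse_eq_divide)
      have "\<forall>\<^sub>F K in sequentially. m_CP \<delta> \<beta> K < count K (a + 1 / real (Suc n)) \<omega>"
        by (rule compare[OF m_CP_div_tendsto[OF assms(2-4)] hi[rule_format] above]) simp
      then show "\<forall>\<^sub>F K in sequentially. ?A K < y"
      proof eventually_elim
        fix K assume "m_CP \<delta> \<beta> K < count K (a + 1 / real (Suc n)) \<omega>"
        then have "?A K \<le> ereal (a + 1 / real (Suc n))"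
          using iff[of K "\<lambda>i. R i \<omega>" "a + 1 / real (Suc n)"] by simp
        moreover have "ereal (a + 1 / real (Suc n)) < y"
          using n z by (intro less_trans[OF _ z(1)]) simp
        ultimately show "?A K < y" by simp
      qed
    qed
  qed
qed

lemma measurable_alpha_CP:
  assumes "\<delta> < 1" "0 < \<beta>" "\<beta> < 1"
  shows "(\<lambda>\<omega>. alpha_CP \<delta> \<beta> K (\<lambda>i. R i \<omega>)) \<in> borel_measurable M"
proof (rule borel_measurable_ereal_of_atMost)
  fix t :: real
  have "{\<omega> \<in> space M. alpha_CP \<delta> \<beta> K (\<lambda>i. R i \<omega>) \<le> ereal t}
      = {\<omega> \<in> space M. real (m_CP \<delta> \<beta> K) \<le> real (count K t \<omega>)}"
    by (simp add: alpha_CP_le_iff[OF assms])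
  also have "\<dots> \<in> sets M" by measurable
  finally show "{\<omega> \<in> space M. alpha_CP \<delta> \<beta> K (\<lambda>i. R i \<omega>) \<le> ereal t} \<in> sets M" .
qed

text \<open>
  The rescaled threshold is at most \<open>x\<close> iff the count at \<open>a + x / sqrt K\<close> reaches the rank. The
  derivative of \<open>F\<close> turns this moving threshold into the drift \<open>f * x\<close>, the rank contributes \<open>s\<close>, and
  \<open>(f * x - s) / \<sigma>\<close> is what results from solving \<open>\<sigma> / f * z + s / f \<le> x\<close> for \<open>z\<close>.
\<close>

lemma alpha_CP_converges_in_distribution:
  assumes \<delta>: "0 < \<delta>" "\<delta> < 1" and \<beta>: "0 < \<beta>" "\<beta> < 1"
    and Fa: "F a = 1 - \<delta>" and deriv: "(F has_real_derivative f) (at a)" and "f > 0"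
  shows "converges_in_distribution M
           (\<lambda>K \<omega>. ereal (sqrt (real K)) * (alpha_CP \<delta> \<beta> K (\<lambda>i. R i \<omega>) - ereal a))
           (distr std_normal_distribution borel
             (\<lambda>z. sqrt (\<delta> * (1 - \<delta>)) / f * z + 1 / f * sqrt (ln (1 / \<beta>) / 2)))"
  unfolding converges_in_distribution_def weak_conv_def
proof (intro conjI allI impI)
  show "(\<lambda>\<omega>. ereal (sqrt (real K)) * (alpha_CP \<delta> \<beta> K (\<lambda>i. R i \<omega>) - ereal a)) \<in> borel_measurable M" for K
    using measurable_alpha_CP[OF \<delta>(2) \<beta>] by measurable
  fix x :: real
  define \<sigma> where "\<sigma> = sqrt (\<delta> * (1 - \<delta>))"
  define s where "s = sqrt (ln (1 / \<beta>) / 2)"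
  have \<sigma>: "\<sigma> > 0" using \<delta> by (simp add: \<sigma>_def)
  have \<sigma>_F: "sqrt (F a * (1 - F a)) = \<sigma>" by (simp add: Fa \<sigma>_def mult.commute)
  have u: "(\<lambda>K. sqrt (real K) * (F (a + x / sqrt (real K)) - F a)) \<longlonglongrightarrow> f * x"
  proof (cases "x = 0")
    case False
    have "filterlim (\<lambda>K. x / sqrt (real K)) (at 0) sequentially"
    proof (rule filterlim_atI)
      show "(\<lambda>K. x / sqrt (real K)) \<longlonglongrightarrow> 0" by real_asymp
      show "\<forall>\<^sub>F K in sequentially. x / sqrt (real K) \<noteq> 0"
        using eventually_gt_at_top[of 0] by eventually_elim (use False in auto)
    qed
    with deriv have "(\<lambda>K. (F (a + x / sqrt (real K)) - F a) / (x / sqrt (real K))) \<longlonglongrightarrow> f"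
      unfolding DERIV_def by (rule filterlim_compose)
    then have "(\<lambda>K. (F (a + x / sqrt (real K)) - F a) / (x / sqrt (real K)) * x) \<longlonglongrightarrow> f * x"
      by (intro tendsto_intros)
    moreover have "y / (x / r) * x = r * y" for y r :: real
      using False by simp
    ultimately show ?thesis by simp
  qed simp
  have main: "(\<lambda>K. prob {\<omega> \<in> space M. m_CP \<delta> \<beta> K \<le> count K (a + x / sqrt (real K)) \<omega>})
      \<longlonglongrightarrow> cdf std_normal_distribution ((f * x - s) / \<sigma>)"
    unfolding \<sigma>_F[symmetric]
    by (rule prob_count_moving_threshold[OF _ _ u])
      (use \<delta> m_CP_sqrt_asymp[OF \<delta>(2) \<beta>] in \<open>simp_all add: Fa s_def\<close>)
  have "\<forall>\<^sub>F K in sequentially.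
      prob {\<omega> \<in> space M. m_CP \<delta> \<beta> K \<le> count K (a + x / sqrt (real K)) \<omega>} =
      prob {\<omega> \<in> space M. ereal (sqrt (real K)) * (alpha_CP \<delta> \<beta> K (\<lambda>i. R i \<omega>) - ereal a) \<le> ereal x}"
    using eventually_gt_at_top[of 0]
    by eventually_elim (simp add: scaled_le_iff alpha_CP_le_iff[OF \<delta>(2) \<beta>])
  with main have "(\<lambda>K. prob {\<omega> \<in> space M. ereal (sqrt (real K)) * (alpha_CP \<delta> \<beta> K (\<lambda>i. R i \<omega>) - ereal a) \<le> ereal x})
      \<longlonglongrightarrow> cdf std_normal_distribution ((f * x - s) / \<sigma>)"
    by (simp add: tendsto_cong)
  also have "cdf std_normal_distribution ((f * x - s) / \<sigma>)
      = cdf (distr std_normal_distribution borel (\<lambda>z. \<sigma> / f * z + 1 / f * s)) x"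
  proof -
    have "(\<lambda>z. \<sigma> / f * z + 1 / f * s) -` {..x} = {..(f * x - s) / \<sigma>}"
      using \<sigma> \<open>f > 0\<close> by (auto simp: field_simps)
    then show ?thesis
      unfolding cdf_def by (subst measure_distr) auto
  qed
  finally show "(\<lambda>K. prob {\<omega> \<in> space M. ereal (sqrt (real K)) * (alpha_CP \<delta> \<beta> K (\<lambda>i. R i \<omega>) - ereal a) \<le> ereal x})
      \<longlonglongrightarrow> cdf (distr std_normal_distribution borel
          (\<lambda>z. sqrt (\<delta> * (1 - \<delta>)) / f * z + 1 / f * sqrt (ln (1 / \<beta>) / 2))) x"
    unfolding \<sigma>_def s_def .
qed

end

section \<open>Asymptotics of the conformal quantile\<close>

theorem lemma4p10:
  fixes M :: "'a measure" and R :: "nat \<Rightarrow> 'a \<Rightarrow> real"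
    and P :: "real measure" and F :: "real \<Rightarrow> real"
    and \<delta> \<beta> \<alpha> :: real
  assumes "prob_space M"
    and "0 < \<delta>" "\<delta> < 1" "0 < \<beta>" "\<beta> < 1"
    and "prob_space.indep_vars M (\<lambda>_. borel) R UNIV"
    and "\<And>i. distr M borel (R i) = P"
    and "F = cdf P"
    and "\<alpha> = Inf {a. F a \<ge> 1 - \<delta>}"
    and "\<exists>\<epsilon>>0. continuous_on (ball \<alpha> \<epsilon>) F \<and> strict_mono_on (ball \<alpha> \<epsilon>) F"
  shows "(AE \<omega> in M. (\<lambda>K. alpha_CP \<delta> \<beta> K (\<lambda>i. R i \<omega>)) \<longlonglongrightarrow> ereal \<alpha>) \<and>
         (\<forall>K\<ge>1. \<forall>t::real.
           measure (Pi\<^sub>M {1..K} (\<lambda>_. P))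
             {r \<in> space (Pi\<^sub>M {1..K} (\<lambda>_. P)). alpha_CP \<delta> \<beta> K r \<le> ereal t}
           = (\<Sum>i = m_CP \<delta> \<beta> K..K. real (K choose i) * F t ^ i * (1 - F t) ^ (K - i))) \<and>
         (\<forall>f\<alpha>. (F has_real_derivative f\<alpha>) (at \<alpha>) \<and> f\<alpha> > 0 \<longrightarrow>
           converges_in_distribution M
             (\<lambda>K \<omega>. ereal (sqrt (real K)) * (alpha_CP \<delta> \<beta> K (\<lambda>i. R i \<omega>) - ereal \<alpha>))
             (distr std_normal_distribution borel
               (\<lambda>z. sqrt (\<delta> * (1 - \<delta>)) / f\<alpha> * z + 1 / f\<alpha> * sqrt (ln (1 / \<beta>) / 2))))"
proof -
  interpret iid_sample M R P F
    using assms(1,6,7,8) by (simp add: iid_sample_def iid_sample_axioms_def)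
  note iff = alpha_CP_le_iff[OF assms(3-5)]
  have q: "0 < 1 - \<delta>" "1 - \<delta> < 1" using assms(2,3) by auto
  obtain \<epsilon> where \<epsilon>: "\<epsilon> > 0" "continuous_on (ball \<alpha> \<epsilon>) F" "strict_mono_on (ball \<alpha> \<epsilon>) F"
    using assms(10) by blast
  have \<alpha>: "\<alpha> = Inf {x. cdf P x \<ge> 1 - \<delta>}" using assms(8,9) by simp
  have "isCont F \<alpha>"
    using \<epsilon>(1,2) by (simp add: continuous_on_eq_continuous_at)
  then have F_\<alpha>: "F \<alpha> = 1 - \<delta>"
    using P.cdf_Inf_level_eq[OF q] unfolding \<alpha> assms(8) by simp
  have below: "F x < 1 - \<delta>" if "x < \<alpha>" for x
    using P.Inf_cdf_level(2)[OF q] that unfolding \<alpha> assms(8) by simp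
  have above: "1 - \<delta> < F x" if "\<alpha> < x" for x
  proof -
    define y where "y = min x (\<alpha> + \<epsilon> / 2)"
    have "\<alpha> < y" "y \<in> ball \<alpha> \<epsilon>" "\<alpha> \<in> ball \<alpha> \<epsilon>" "y \<le> x"
      using that \<epsilon>(1) by (auto simp: y_def dist_real_def)
    then have "F \<alpha> < F y" "F y \<le> F x"
      using \<epsilon>(3) F_mono by (auto simp: strict_mono_on_def)
    then show ?thesis using F_\<alpha> by simp
  qed
  have "measure (Pi\<^sub>M {1..K} (\<lambda>_. P))
      {r \<in> space (Pi\<^sub>M {1..K} (\<lambda>_. P)). alpha_CP \<delta> \<beta> K r \<le> ereal t}
      = (\<Sum>i = m_CP \<delta> \<beta> K..K. real (K choose i) * F t ^ i * (1 - F t) ^ (K - i))" for K t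
    unfolding iff assms(8) by (rule measure_PiM_count_below[OF P.prob_space_axioms P.events_eq_borel])
  then show ?thesis
    using AE_alpha_CP_tendsto[OF assms(2-5) below above]
      alpha_CP_converges_in_distribution[OF assms(2-5) F_\<alpha>]
    by blast
qed

end
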